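(* Let $\mathcal B=\mathcal B_1,\mathcal B_2,\ldots$ be the sequence of even binary partitions defined in the context, and let $k\ge1$. Then: (i) $|\mathcal B_k|$ is the smallest integer $n\ge0$ such that $k\le b(n)$. (ii) With $n=|\mathcal B_k|$, we have $\lfloor \mathcal B_k/2\rfloor=\mathcal B_\ell$, where $\ell=k-b(n-2)$ if $n\equiv0\pmod 4$, and $\ell=b(n)+1-k$ if $n\equiv 2\pmod 4$. Conversely, let $P$ be an even binary partition with trail $\tau=\tau_0,\tau_1,\tau_2,\ldots$, so that $\lfloor P/2\rfloor$ has trail $\tau_1,\tau_2,\ldots$. If $\lfloor P/2\rfloor=\mathcal B_\ell$, then $P=\mathcal B_k$ where $k=b(\tau_0-2)+\ell$ if $\tau_0\equiv0\pmod4$, and $k=b(\tau_0)+1-\ell$ if $\tau_0\equiv2\pmod4$. Together with the base case that the trail $0,0,\ldots$ (i.e. $P=\emptyset$) corresponds to $\mathcal B_{b(0)}=\mathcal B_1=\emptyset$, this recurrence determines the position in $\mathcal B$ of the even binary partition with any given trail.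
   Context: A binary partition of $n\ge0$ is a multiset of powers of two ($1,2,4,\dots$) summing to $n$; $\emptyset$ is the unique binary partition of $0$. Let $b(n)$ be the number of binary partitions of $n$, with the convention $b(m)=0$ for $m<0$. For a partition $P$, $|P|$ is the sum of its parts, $P+1$ denotes $P$ with an extra part $1$ added, and $2\times P$ denotes $P$ with every part doubled. Define ordered lists $\mathcal B(n)$ of all binary partitions of $n$ recursively: $\mathcal B(0)=(\emptyset)$; for $n\ge1$: - if $n$ is odd, $\mathcal B(n)$ is the list $(Q+1)$ for $Q$ running through $\mathcal B(n-1)$ in order; - if $n\equiv0\pmod 4$, $\mathcal B(n)$ is the list $(Q+1)$ for $Q$ running through $\mathcal B(n-1)$ in order, followed by $(2\times Q)$ for $Q$ running through $\mathcal B(n/2)$ in order; - if $n\equiv2\pmod 4$, $\mathcal B(n)$ is the list $(Q+1)$ for $Q$ running through $\mathcal B(n-1)$ in order, followed by $(2\times Q)$ for $Q$ running through $\mathcal B(n/2)$ in reverse order. An even binary partition is a binary partition with no part equal to $1$. The infinite sequence $\mathcal B=\mathcal B_1,\mathcal B_2,\dots$ is the concatenation, over $n=0,2,4,6,\dots$ in increasing order, of the blocks: for $n=0$ the single term $\emptyset$; for even $n\ge2$ the terms of $\mathcal B(n)$ having no part equal to $1$ (these are its last $b(n/2)$ terms), in the order they occur in $\mathcal B(n)$. For an even binary partition $P$, $\lfloor P/2\rfloor$ denotes the even binary partition obtained by halving every part of $P$ and then deleting all parts equal to $1$. The trail of $P$ is the sequence $\tau(P)=\tau_0,\tau_1,\tau_2,\ldots$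 with $\tau_i=|\lfloor P/2^i\rfloor|$, where $\lfloor P/2^i\rfloor$ denotes $i$ iterations of the map $P\mapsto\lfloor P/2\rfloor$ (so $\tau_0=|P|$). *)

theory Defs
  imports "HOL-Library.Multiset" "HOL-Library.Stream"
begin

definition binary_partition :: "nat multiset \<Rightarrow> bool" where
  "binary_partition P \<longleftrightarrow> (\<forall>p \<in># P. \<exists>i. p = 2 ^ i)"

definition even_binary_partition :: "nat multiset \<Rightarrow> bool" where
  "even_binary_partition P \<longleftrightarrow> binary_partition P \<and> 1 \<notin># P"

text \<open>The argument is an integer so that \<open>n - 2\<close> does not truncate; for \<open>n < 0\<close> the set
  is empty and the count is \<open>0\<close>.\<close>
definition num_binary_partitions :: "int \<Rightarrow> nat" where
  "num_binary_partitions n = card {P. binary_partition P \<and> int (sum_mset P) = n}"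

function binary_partition_list :: "nat \<Rightarrow> nat multiset list" where
  "binary_partition_list n =
    (if n = 0 then [{#}]
     else if odd n then map (add_mset 1) (binary_partition_list (n - 1))
     else if n mod 4 = 0 then
       map (add_mset 1) (binary_partition_list (n - 1)) @
       map (image_mset ((*) 2)) (binary_partition_list (n div 2))
     else
       map (add_mset 1) (binary_partition_list (n - 1)) @
       map (image_mset ((*) 2)) (rev (binary_partition_list (n div 2))))"
  by pat_completeness auto
termination
  by (relation "measure id") auto

declare binary_partition_list.simps [simp del]

definition even_block :: "nat \<Rightarrow> nat multiset list" where
  "even_block n = filter (\<lambda>P. 1 \<notin># P) (binary_partition_list n)"

text \<open>The concatenation of the blocks for \<open>0, 2, 4, \<dots>\<close> (each is nonempty, as \<open>flat\<close> requires).
  Positions count from \<open>1\<close>; the value at \<open>0\<close> has no meaning.\<close>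
definition even_partition_seq :: "nat \<Rightarrow> nat multiset" where
  "even_partition_seq k = flat (smap (\<lambda>m. even_block (2 * m)) nats) !! (k - 1)"

definition half_partition :: "nat multiset \<Rightarrow> nat multiset" where
  "half_partition P = filter_mset (\<lambda>p. p \<noteq> 1) (image_mset (\<lambda>p. p div 2) P)"

definition trail :: "nat multiset \<Rightarrow> nat \<Rightarrow> nat" where
  "trail P i = sum_mset ((half_partition ^^ i) P)"

text \<open>The recurrence, with its base case, for a position as a function of the trail. Only the
  values at trails of even binary partitions are constrained.\<close>
definition trail_position_recurrence :: "((nat \<Rightarrow> nat) \<Rightarrow> nat) \<Rightarrow> bool" where
  "trail_position_recurrence pos \<longleftrightarrow>
     pos (\<lambda>_. 0) = num_binary_partitions 0 \<and>
     (\<forall>P \<tau>. even_binary_partition P \<and> \<tau> = trail P \<longrightarrow>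
       (\<tau> 0 mod 4 = 0 \<longrightarrow>
          pos \<tau> = num_binary_partitions (int (\<tau> 0) - 2) + pos (\<lambda>i. \<tau> (Suc i))) \<and>
       (\<tau> 0 mod 4 = 2 \<longrightarrow>
          int (pos \<tau>) = int (num_binary_partitions (int (\<tau> 0))) + 1 - int (pos (\<lambda>i. \<tau> (Suc i)))))"

end

theory Submission
  imports Defs
begin

text \<open>Deleting the ones from the terms of \<open>\<B>(n)\<close> yields, in order, exactly the initial segment of
  length \<open>b(n)\<close> of \<open>\<B>\<close>, because \<open>\<B>(2m)\<close> is \<open>\<B>(2m - 2)\<close> with two ones added, followed by the block
  for \<open>2m\<close>. On the other hand that block is the doubling of \<open>\<B>(m)\<close>, reversed if \<open>m\<close> is odd, and
  halving a doubled partition amounts to deleting its original ones. So halving maps the block for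
  \<open>2m\<close> onto the first \<open>b(m)\<close> terms of \<open>\<B>\<close>, forwards or backwards.\<close>

definition drop_ones :: "nat multiset \<Rightarrow> nat multiset" where
  "drop_ones P = filter_mset (\<lambda>p. p \<noteq> 1) P"

abbreviation double :: "nat multiset \<Rightarrow> nat multiset" where
  "double \<equiv> image_mset ((*) 2)"

section \<open>Binary partitions\<close>

lemma binary_partition_empty [simp]: "binary_partition {#}"
  by (simp add: binary_partition_def)

lemma binary_partition_add_one [simp]:
  "binary_partition (add_mset (Suc 0) P) \<longleftrightarrow> binary_partition P"
  by (auto simp: binary_partition_def intro: exI[of _ 0])

lemma binary_partition_double:
  assumes "binary_partition P"
  shows "binary_partition (double P)"
  unfolding binary_partition_def
proof
  fix p assume "p \<in># double P"
  then obtain q where q: "q \<in># P" "p = 2 * q" by auto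
  with assms obtain i where "q = 2 ^ i" by (auto simp: binary_partition_def)
  with q show "\<exists>i. p = 2 ^ i" by (intro exI[of _ "Suc i"]) simp
qed

lemma one_notin_double [simp]: "Suc 0 \<notin># double P"
  by auto

lemma sum_mset_double [simp]: "sum_mset (double P) = 2 * sum_mset P"
  by (induction P) auto

lemma inj_double: "inj double"
proof (rule injI)
  fix P Q assume "double P = double Q"
  then have "image_mset (\<lambda>p. p div 2) (double P) = image_mset (\<lambda>p. p div 2) (double Q)"
    by simp
  then show "P = Q" by (simp add: multiset.map_comp comp_def)
qed

lemma half_double [simp]: "half_partition (double P) = drop_ones P"
  by (simp add: half_partition_def drop_ones_def multiset.map_comp comp_def)

lemma drop_ones_add_one [simp]: "drop_ones (add_mset (Suc 0) P) = drop_ones P"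
  by (simp add: drop_ones_def)

lemma drop_ones_double [simp]: "drop_ones (double P) = double P"
  unfolding drop_ones_def by (rule filter_mset_eq_conv[THEN iffD2]) auto

lemma half_empty [simp]: "half_partition {#} = {#}"
  by (simp add: half_partition_def)

text \<open>Without the part 1 every exponent is positive, so halving all parts stays within the
  powers of two and is undone by \<open>double\<close>.\<close>

lemma even_partitionE:
  assumes "even_binary_partition P"
  obtains Q where "binary_partition Q" "P = double Q"
proof
  define Q where "Q = image_mset (\<lambda>p. p div 2) P"
  have pow: "\<exists>i. p = 2 ^ Suc i" if "p \<in># P" for p
  proof -
    from that assms obtain i where "p = 2 ^ i" "p \<noteq> 1"
      unfolding even_binary_partition_def binary_partition_def by metis
    then show ?thesis by (cases i) auto
  qed
  show "binary_partition Q"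
    unfolding binary_partition_def
  proof
    fix p assume "p \<in># Q"
    then obtain q where "q \<in># P" "p = q div 2" by (auto simp: Q_def)
    with pow[of q] show "\<exists>i. p = 2 ^ i" by auto
  qed
  have "double Q = image_mset (\<lambda>p. p) P"
    unfolding Q_def multiset.map_comp comp_def
    by (rule image_mset_cong) (use pow in force)
  then show "P = double Q" by simp
qed

lemma even_partition_drop_ones: "binary_partition P \<Longrightarrow> even_binary_partition (drop_ones P)"
  by (simp add: even_binary_partition_def binary_partition_def drop_ones_def)

lemma even_partition_half: "even_binary_partition P \<Longrightarrow> even_binary_partition (half_partition P)"
  by (erule even_partitionE) (simp add: even_partition_drop_ones)

lemma binary_partition_sum_0_iff:
  assumes "binary_partition P"
  shows "sum_mset P = 0 \<longleftrightarrow> P = {#}"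
proof
  assume "sum_mset P = 0"
  then have "\<forall>p\<in>#P. p = 0" by simp
  with assms have "p \<notin># P" for p by (force simp: binary_partition_def)
  then show "P = {#}" by (intro multiset_eqI) (simp add: not_in_iff)
qed simp

lemma drop_ones_decomp: "P = drop_ones P + replicate_mset (count P 1) 1"
  by (simp add: multiset_eq_iff drop_ones_def)

lemma sum_mset_drop_ones: "sum_mset P = sum_mset (drop_ones P) + count P 1"
proof -
  have "sum_mset P = sum_mset (drop_ones P + replicate_mset (count P 1) 1)"
    using drop_ones_decomp[of P] by simp
  then show ?thesis by (simp add: sum_mset_replicate_mset)
qed

text \<open>For a fixed sum the number of deleted ones is forced, so they can be restored.\<close>

lemma drop_ones_inj:
  assumes "drop_ones P = drop_ones Q" "sum_mset P = sum_mset Q"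
  shows "P = Q"
proof -
  have "count P 1 = count Q 1"
    using sum_mset_drop_ones[of P] sum_mset_drop_ones[of Q] assms by simp
  then show ?thesis using drop_ones_decomp[of P] drop_ones_decomp[of Q] assms(1) by simp
qed

text \<open>Writing \<open>P = double Q\<close>, the half has sum at most \<open>sum_mset Q\<close>,
  which is positive and half of the sum of \<open>P\<close>. This is the measure for induction along
  repeated halving.\<close>

lemma sum_mset_half_less:
  assumes "even_binary_partition P" "P \<noteq> {#}"
  shows "sum_mset (half_partition P) < sum_mset P"
proof -
  obtain Q where Q: "binary_partition Q" "P = double Q"
    using assms(1) by (rule even_partitionE)
  with assms(2) have "sum_mset Q > 0"
    using binary_partition_sum_0_iff[of Q] by (cases "sum_mset Q") auto
  then show ?thesis using Q sum_mset_drop_ones[of Q] by simp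
qed

section \<open>The lists of all binary partitions\<close>

lemma binary_partition_list_0: "binary_partition_list 0 = [{#}]"
  by (simp add: binary_partition_list.simps)

lemma binary_partition_list_odd:
  "binary_partition_list (Suc (2 * m)) = map (add_mset 1) (binary_partition_list (2 * m))"
  by (subst binary_partition_list.simps) simp

text \<open>Gives the order in which the block for \<open>2 * m\<close> runs through the halves of
  its terms. As \<open>2 * m mod 4 = 0\<close> exactly when \<open>m\<close> is even, parity of
  \<open>m\<close> decides the direction.\<close>

definition halved_list :: "nat \<Rightarrow> nat multiset list" where
  "halved_list m = (if even m then binary_partition_list m else rev (binary_partition_list m))"

lemma binary_partition_list_even:
  assumes "m > 0"
  shows "binary_partition_list (2 * m) =
    map (add_mset 1) (binary_partition_list (2 * m - 1)) @ map double (halved_list m)"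
proof -
  have "2 * m mod 4 = 0 \<longleftrightarrow> even m" by presburger
  with assms show ?thesis
    by (subst binary_partition_list.simps) (simp add: halved_list_def)
qed

text \<open>Mirrors the recursion of the lists: either a part 1 can be removed, or all parts are
  even and so is their sum.\<close>

lemma mem_partition_cases:
  assumes "binary_partition P" "sum_mset P = n" "n > 0"
  obtains Q where "P = add_mset 1 Q" "binary_partition Q" "sum_mset Q = n - 1"
  | Q where "even n" "P = double Q" "binary_partition Q" "sum_mset Q = n div 2"
proof (cases "1 \<in># P")
  case True
  then obtain Q where "P = add_mset 1 Q" by (metis insert_DiffM)
  with assms show ?thesis using that(1)[of Q] by auto
next
  case False
  with assms have "even_binary_partition P" by (simp add: even_binary_partition_def)
  then obtain Q where "binary_partition Q" "P = double Q" by (rule even_partitionE)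
  with assms show ?thesis using that(2)[of Q] by auto
qed

lemma nat_parity_cases [case_names zero odd even]:
  obtains "n = 0" | m where "n = Suc (2 * m)" | m where "n = 2 * m" "m > 0"
proof (cases "even n")
  case True
  then obtain m where "n = 2 * m" ..
  with that(1) that(3)[of m] show ?thesis by (cases "m = 0") auto
next
  case False
  then obtain m where "n = Suc (2 * m)" by (auto elim: oddE)
  with that(2) show ?thesis .
qed

text \<open>Strong induction, because an even \<open>n\<close> refers back to both
  \<open>n - 1\<close> and \<open>n div 2\<close>. Reversing a list does not change its set.\<close>

lemma set_binary_partition_list:
  "set (binary_partition_list n) = {P. binary_partition P \<and> sum_mset P = n}"
proof (induction n rule: less_induct)
  case (less n)
  show ?case
  proof (cases rule: nat_parity_cases[of n])
    case zero
    then show ?thesis using binary_partition_sum_0_iff by (auto simp: binary_partition_list_0)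
  next
    case (odd m)
    have IH: "set (binary_partition_list (2 * m)) = {P. binary_partition P \<and> sum_mset P = 2 * m}"
      by (rule less) (use odd in simp)
    have set_n: "set (binary_partition_list n) = add_mset 1 ` set (binary_partition_list (2 * m))"
      using odd by (simp add: binary_partition_list_odd)
    show ?thesis
    proof (intro equalityI subsetI)
      fix P assume "P \<in> set (binary_partition_list n)"
      then obtain Q where "P = add_mset 1 Q" "binary_partition Q" "sum_mset Q = 2 * m"
        unfolding set_n IH by blast
      then show "P \<in> {P. binary_partition P \<and> sum_mset P = n}"
        using odd by simp
    next
      fix P assume "P \<in> {P. binary_partition P \<and> sum_mset P = n}"
      then have P: "binary_partition P" "sum_mset P = n" by auto
      have n: "n > 0" "n - 1 = 2 * m" "odd n" using odd by auto
      show "P \<in> set (binary_partition_list n)"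
        unfolding set_n IH by (rule mem_partition_cases[OF P n(1)]) (use n in auto)
    qed
  next
    case (even m)
    have IH1: "set (binary_partition_list (n - 1)) = {P. binary_partition P \<and> sum_mset P = n - 1}"
      by (rule less) (use even in simp)
    have "set (binary_partition_list m) = {P. binary_partition P \<and> sum_mset P = m}"
      by (rule less) (use even in simp)
    then have IH2: "set (halved_list m) = {P. binary_partition P \<and> sum_mset P = m}"
      by (simp add: halved_list_def)
    have set_n: "set (binary_partition_list n) =
        add_mset 1 ` set (binary_partition_list (n - 1)) \<union> double ` set (halved_list m)"
      using even by (simp add: binary_partition_list_even)
    show ?thesis
    proof (intro equalityI subsetI)
      fix P assume "P \<in> set (binary_partition_list n)"
      then consider Q where "P = add_mset 1 Q" "binary_partition Q" "sum_mset Q = n - 1"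
        | Q where "P = double Q" "binary_partition Q" "sum_mset Q = m"
        unfolding set_n IH1 IH2 by blast
      then show "P \<in> {P. binary_partition P \<and> sum_mset P = n}"
        by cases (use even in \<open>simp_all add: binary_partition_double\<close>)
    next
      fix P assume "P \<in> {P. binary_partition P \<and> sum_mset P = n}"
      then have P: "binary_partition P" "sum_mset P = n" by auto
      have n: "n > 0" "n div 2 = m" using even by auto
      show "P \<in> set (binary_partition_list n)"
        unfolding set_n IH1 IH2 by (rule mem_partition_cases[OF P n(1)]) (use n in auto)
    qed
  qed
qed

text \<open>Adding a 1 and doubling are injective, and the two pieces of an even list are disjoint
  since only the first has terms containing 1.\<close>

lemma distinct_binary_partition_list: "distinct (binary_partition_list n)"
proof (induction n rule: less_induct)
  case (less n)
  have inj1: "inj_on (add_mset 1) A" for A :: "nat multiset set" by (simp add: inj_on_def)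
  show ?case
  proof (cases rule: nat_parity_cases[of n])
    case zero
    then show ?thesis by (simp add: binary_partition_list_0)
  next
    case (odd m)
    then show ?thesis using less[of "2 * m"] inj1
      by (simp add: binary_partition_list_odd distinct_map)
  next
    case (even m)
    have "add_mset 1 P \<noteq> double Q" for P Q
      using one_notin_double[of Q] by (metis One_nat_def union_single_eq_member)
    then show ?thesis using even less[of "n - 1"] less[of m] inj1
      by (auto simp: binary_partition_list_even distinct_map halved_list_def
          intro: inj_on_subset[OF inj_double])
  qed
qed

lemma length_binary_partition_list:
  "length (binary_partition_list n) = num_binary_partitions (int n)"
  using distinct_card[OF distinct_binary_partition_list[of n]]
  \<comment> \<open>\<open>of_nat_sum_mset\<close> would push \<open>int\<close> inside the sum;
    without it \<open>int (sum_mset P) = int n\<close> cancels to naturals.\<close>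
  by (simp add: set_binary_partition_list num_binary_partitions_def del: of_nat_sum_mset)

lemma length_halved_list: "length (halved_list m) = num_binary_partitions (int m)"
  by (simp add: halved_list_def length_binary_partition_list)

lemma num_binary_partitions_pos: "num_binary_partitions (int n) > 0"
proof -
  have "replicate_mset n 1 \<in> set (binary_partition_list n)"
    by (auto simp: set_binary_partition_list binary_partition_def sum_mset_replicate_mset
        intro: exI[of _ 0])
  then show ?thesis
    by (metis length_binary_partition_list length_pos_if_in_set)
qed

text \<open>The filter removes the whole first piece of the list, whose terms contain 1, and keeps
  the whole doubled piece.\<close>

lemma even_block_eq: "even_block (2 * m) = map double (halved_list m)"
proof (cases "m = 0")
  case True
  then show ?thesis by (simp add: even_block_def halved_list_def binary_partition_list_0)
next
  case False
  then show ?thesis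
    by (auto simp: even_block_def binary_partition_list_even intro!: filter_True)
qed

section \<open>Initial segments of the sequence\<close>

text \<open>Here \<open>m\<close> counts blocks, so the last one included is that for
  \<open>2 * m - 2\<close>. Finite prefixes replace the stream in all counting arguments.\<close>

definition even_prefix :: "nat \<Rightarrow> nat multiset list" where
  "even_prefix m = concat (map (\<lambda>i. even_block (2 * i)) [0..<m])"

lemma even_prefix_0 [simp]: "even_prefix 0 = []"
  by (simp add: even_prefix_def)

lemma even_prefix_Suc: "even_prefix (Suc m) = even_prefix m @ even_block (2 * m)"
  by (simp add: even_prefix_def)

text \<open>Induction on \<open>m\<close>: the two added ones disappear under
  \<open>drop_ones\<close>, and the new doubled terms are fixed by it.\<close>

lemma map_drop_ones_binary_partition_list: "map drop_ones (binary_partition_list (2 * m)) = even_prefix (Suc m)"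
proof (induction m)
  case 0
  then show ?case
    using even_block_eq[of 0]
    by (simp add: even_prefix_Suc halved_list_def binary_partition_list_0 drop_ones_def)
next
  case (Suc m)
  have "2 * Suc m - 1 = Suc (2 * m)" by simp
  then have "map drop_ones (binary_partition_list (2 * Suc m)) =
      map drop_ones (binary_partition_list (2 * m)) @ map double (halved_list (Suc m))"
    using binary_partition_list_even[of "Suc m"] binary_partition_list_odd[of m]
    by (simp add: comp_def del: mult_Suc_right)
  then show ?case
    unfolding Suc by (subst even_prefix_Suc) (simp only: even_block_eq)
qed

text \<open>An odd list only adds a 1 to the even list before it. Both parities are needed because
  the block for \<open>2 * m\<close> is built from the list for arbitrary \<open>m\<close>.\<close>

lemma map_drop_ones_binary_partition_list_div: "map drop_ones (binary_partition_list n) = even_prefix (Suc (n div 2))"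
proof (cases "even n")
  case True
  then show ?thesis using map_drop_ones_binary_partition_list[of "n div 2"] by simp
next
  case False
  then obtain m where "n = Suc (2 * m)" by (auto elim: oddE)
  then show ?thesis using map_drop_ones_binary_partition_list[of m]
    by (simp add: binary_partition_list_odd comp_def)
qed

lemma length_even_prefix: "length (even_prefix m) = num_binary_partitions (2 * int m - 2)"
proof (cases m)
  case 0
  \<comment> \<open>The empty prefix corresponds to the argument -2, where the convention for
    negative arguments gives 0.\<close>
  have "{P. binary_partition P \<and> int (sum_mset P) = - 2} = {}"
    by (auto simp del: of_nat_sum_mset)
  then show ?thesis by (simp add: 0 num_binary_partitions_def del: of_nat_sum_mset)
next
  case (Suc m')
  then show ?thesis
    using arg_cong[OF map_drop_ones_binary_partition_list[of m'], of length]
    by (simp add: length_binary_partition_list)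
qed

lemma length_even_prefix_Suc:
  "length (even_prefix (Suc m)) = num_binary_partitions (int (2 * m))"
  by (simp add: length_even_prefix)

text \<open>In terms of prefix lengths this is the classical recurrence b(2m) = b(2m - 2) +
  b(m).\<close>

lemma length_even_prefix_step:
  "length (even_prefix (Suc m)) = length (even_prefix m) + num_binary_partitions (int m)"
  by (simp add: even_prefix_Suc even_block_eq length_halved_list)

lemma length_even_prefix_mono: "m \<le> m' \<Longrightarrow> length (even_prefix m) \<le> length (even_prefix m')"
  by (rule lift_Suc_mono_le[of "\<lambda>m. length (even_prefix m)"]) (simp add: even_prefix_Suc)

text \<open>Every block is nonempty. Hence position \<open>k\<close> is already reached within the
  first \<open>k\<close> blocks.\<close>

lemma length_even_prefix_ge: "m \<le> length (even_prefix m)"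
proof (induction m)
  case (Suc m)
  then show ?case using num_binary_partitions_pos[of m] length_even_prefix_step[of m] by linarith
qed simp

lemma set_even_prefix:
  "set (even_prefix (Suc m)) = {P. even_binary_partition P \<and> sum_mset P \<le> 2 * m}"
proof (intro equalityI subsetI)
  fix P assume "P \<in> set (even_prefix (Suc m))"
  then obtain Q where "Q \<in> set (binary_partition_list (2 * m))" "P = drop_ones Q"
    unfolding map_drop_ones_binary_partition_list[symmetric] by auto
  then show "P \<in> {P. even_binary_partition P \<and> sum_mset P \<le> 2 * m}"
    using sum_mset_drop_ones[of Q] by (auto simp: set_binary_partition_list even_partition_drop_ones)
next
  fix P assume "P \<in> {P. even_binary_partition P \<and> sum_mset P \<le> 2 * m}"
  then have P: "binary_partition P" "1 \<notin># P" "sum_mset P \<le> 2 * m"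
    by (auto simp: even_binary_partition_def)
  \<comment> \<open>Padding \<open>P\<close> with ones up to the sum \<open>2 * m\<close> gives a
    preimage under \<open>drop_ones\<close>.\<close>
  define Q where "Q = P + replicate_mset (2 * m - sum_mset P) 1"
  have "binary_partition Q"
    using P(1) by (auto simp: Q_def binary_partition_def intro: exI[of _ 0])
  moreover have "sum_mset Q = 2 * m"
    using P(3) by (simp add: Q_def sum_mset_replicate_mset)
  moreover have "drop_ones Q = P"
    using P(2) by (auto simp: Q_def drop_ones_def multiset_eq_iff not_in_iff)
  ultimately show "P \<in> set (even_prefix (Suc m))"
    unfolding map_drop_ones_binary_partition_list[symmetric] by (auto simp: set_binary_partition_list image_iff)
qed

text \<open>\<open>drop_ones\<close> is injective on the partitions of one number, so distinctness
  carries over from the full list.\<close>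

lemma distinct_even_prefix: "distinct (even_prefix m)"
proof (cases m)
  case (Suc m')
  have "inj_on drop_ones (set (binary_partition_list (2 * m')))"
    by (rule inj_onI) (auto simp: set_binary_partition_list intro: drop_ones_inj)
  then show ?thesis
    by (simp add: Suc map_drop_ones_binary_partition_list[symmetric] distinct_map distinct_binary_partition_list)
qed simp

section \<open>Indexing the infinite sequence by block and offset\<close>

lemma flat_eq_concat_shift:
  assumes "\<And>xs. xs \<in> sset s \<Longrightarrow> xs \<noteq> []"
  shows "flat s = concat (stake n s) @- flat (sdrop n s)"
  using assms
proof (induction n arbitrary: s)
  case (Suc n)
  have "flat s = shd s @- flat (stl s)"
    using Suc.prems[OF shd_sset] by (rule flat_unfold)
  also have "flat (stl s) = concat (stake n (stl s)) @- flat (sdrop n (stl s))"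
    by (rule Suc.IH) (rule Suc.prems[OF stl_sset])
  finally show ?case by simp
qed simp

text \<open>Any prefix that is long enough may be used to read off a term. The \<open>Suc\<close>
  converts list indices from 0 to positions from 1.\<close>

lemma even_partition_seq_eq_nth:
  assumes "i < length (even_prefix m)"
  shows "even_partition_seq (Suc i) = even_prefix m ! i"
proof -
  let ?s = "smap (\<lambda>m. even_block (2 * m)) nats"
  have "xs \<noteq> []" if "xs \<in> sset ?s" for xs
  proof -
    obtain m where "xs = even_block (2 * m)" using \<open>xs \<in> sset ?s\<close> by (auto simp: stream.set_map)
    then show ?thesis using num_binary_partitions_pos[of m] length_halved_list[of m]
      by (auto simp: even_block_eq)
  qed
  then have "flat ?s = concat (stake m ?s) @- flat (sdrop m ?s)"
    by (rule flat_eq_concat_shift)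
  also have "concat (stake m ?s) = even_prefix m"
    by (simp add: even_prefix_def stake_smap stake_siterate)
  finally show ?thesis using assms by (simp add: even_partition_seq_def)
qed

lemma even_partition_seq_obtain:
  assumes "k \<ge> 1"
  obtains m j where "j < num_binary_partitions (int m)" "k = Suc (length (even_prefix m) + j)"
proof -
  \<comment> \<open>The first block whose end reaches position \<open>k\<close>; by minimality the
    earlier blocks stop short of \<open>k\<close>, and the rest is the offset
    \<open>j\<close>.\<close>
  define m where "m = (LEAST m. k \<le> length (even_prefix (Suc m)))"
  have "k \<le> length (even_prefix (Suc k))" using length_even_prefix_ge[of "Suc k"] by linarith
  then have ub: "k \<le> length (even_prefix (Suc m))" unfolding m_def by (rule LeastI)
  have lb: "length (even_prefix m) < k"
  proof (cases m)
    case 0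
    then show ?thesis using assms by simp
  next
    case (Suc m')
    then show ?thesis using not_less_Least[of m' "\<lambda>m. k \<le> length (even_prefix (Suc m))"]
      by (simp add: m_def[symmetric])
  qed
  show ?thesis
    using that[of "k - length (even_prefix m) - 1" m] ub lb length_even_prefix_step[of m] by linarith
qed

lemma even_partition_seq_block:
  assumes "j < num_binary_partitions (int m)"
  shows "even_partition_seq (Suc (length (even_prefix m) + j)) = double (halved_list m ! j)"
proof -
  have "even_partition_seq (Suc (length (even_prefix m) + j)) =
      even_prefix (Suc m) ! (length (even_prefix m) + j)"
    using assms by (intro even_partition_seq_eq_nth) (simp add: length_even_prefix_step)
  also have "\<dots> = double (halved_list m ! j)"
    using assms by (simp add: even_prefix_Suc even_block_eq nth_append length_halved_list)
  finally show ?thesis by simp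
qed

text \<open>Brings the halves of a block back to the start of the sequence: without their ones, the
  terms of any list form a prefix.\<close>

lemma drop_ones_nth:
  assumes "j < num_binary_partitions (int m)"
  shows "drop_ones (binary_partition_list m ! j) = even_partition_seq (Suc j)"
proof -
  have "drop_ones (binary_partition_list m ! j) = even_prefix (Suc (m div 2)) ! j"
    using assms by (simp flip: map_drop_ones_binary_partition_list_div add: length_binary_partition_list)
  also have "\<dots> = even_partition_seq (Suc j)"
    by (rule even_partition_seq_eq_nth[symmetric])
      (use assms in \<open>simp flip: map_drop_ones_binary_partition_list_div add: length_binary_partition_list\<close>)
  finally show ?thesis .
qed

lemma half_even_partition_seq_even:
  assumes "even m" "j < num_binary_partitions (int m)"
  shows "half_partition (even_partition_seq (Suc (length (even_prefix m) + j))) =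
    even_partition_seq (Suc j)"
  using assms by (simp add: even_partition_seq_block halved_list_def drop_ones_nth)

lemma half_even_partition_seq_odd:
  assumes "odd m" "j < num_binary_partitions (int m)"
  shows "half_partition (even_partition_seq (Suc (length (even_prefix m) + j))) =
    even_partition_seq (num_binary_partitions (int m) - j)"
proof -
  let ?b = "num_binary_partitions (int m)"
  \<comment> \<open>Reversal sends index \<open>j\<close> to \<open>?b - Suc j\<close>, which is
    position \<open>?b - j\<close> counted from 1.\<close>
  have "halved_list m ! j = binary_partition_list m ! (?b - Suc j)"
    using assms by (simp add: halved_list_def rev_nth length_binary_partition_list)
  then show ?thesis
    using assms drop_ones_nth[of "?b - Suc j" m]
    by (simp add: even_partition_seq_block Suc_diff_Suc)
qed

lemma halved_list_nth_mem:
  assumes "j < num_binary_partitions (int m)"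
  shows "binary_partition (halved_list m ! j)" "sum_mset (halved_list m ! j) = m"
proof -
  have "halved_list m ! j \<in> set (halved_list m)"
    using assms by (simp add: length_halved_list)
  then have "halved_list m ! j \<in> set (binary_partition_list m)"
    by (simp add: halved_list_def split: if_splits)
  then show "binary_partition (halved_list m ! j)" "sum_mset (halved_list m ! j) = m"
    by (simp_all add: set_binary_partition_list)
qed

lemma sum_mset_even_partition_seq:
  assumes "j < num_binary_partitions (int m)"
  shows "sum_mset (even_partition_seq (Suc (length (even_prefix m) + j))) = 2 * m"
  using halved_list_nth_mem[OF assms] by (simp only: even_partition_seq_block[OF assms] sum_mset_double)

lemma even_partition_seq_surj:
  assumes "even_binary_partition P"
  obtains k where "k \<ge> 1" "even_partition_seq k = P"
proof -
  have "P \<in> set (even_prefix (Suc (sum_mset P)))"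
    using assms by (simp add: set_even_prefix)
  then obtain i where "i < length (even_prefix (Suc (sum_mset P)))"
      "even_prefix (Suc (sum_mset P)) ! i = P"
    by (auto simp: in_set_conv_nth)
  then show ?thesis using that[of "Suc i"] even_partition_seq_eq_nth by simp
qed

text \<open>Both positions lie in one common prefix, whose entries are distinct.\<close>

lemma even_partition_seq_inj:
  assumes "k \<ge> 1" "l \<ge> 1" "even_partition_seq k = even_partition_seq l"
  shows "k = l"
proof -
  let ?m = "max k l"
  have "k - 1 < length (even_prefix ?m)" "l - 1 < length (even_prefix ?m)"
    using length_even_prefix_ge[of ?m] assms(1,2) by linarith+
  with assms show ?thesis
    using even_partition_seq_eq_nth[of "k - 1" ?m] even_partition_seq_eq_nth[of "l - 1" ?m]
      distinct_even_prefix[of ?m] by (simp add: nth_eq_iff_index_eq)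
qed

lemma even_partition_seq_1: "even_partition_seq 1 = {#}"
  using even_partition_seq_block[of 0 0] num_binary_partitions_pos[of 0]
  by (simp add: halved_list_def binary_partition_list_0)

lemma num_binary_partitions_0: "num_binary_partitions 0 = 1"
  using length_binary_partition_list[of 0] by (simp add: binary_partition_list_0)

section \<open>The recurrence for positions\<close>

text \<open>Position \<open>k\<close> lies in the block for \<open>2 * M\<close>, past all earlier
  blocks. A bound \<open>k <= b(m)\<close> therefore forces the prefix of length b(m) to reach into
  that block, so \<open>M\<close> is at most \<open>m div 2\<close>.\<close>

lemma even_partition_seq_sum_least:
  assumes "k \<ge> 1"
  shows "k \<le> num_binary_partitions (int (sum_mset (even_partition_seq k)))"
    and "k \<le> num_binary_partitions (int m) \<Longrightarrow> sum_mset (even_partition_seq k) \<le> m"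
proof -
  from assms obtain M j where Mj: "j < num_binary_partitions (int M)"
    "k = Suc (length (even_prefix M) + j)" by (rule even_partition_seq_obtain)
  have sum: "sum_mset (even_partition_seq k) = 2 * M"
    using Mj by (simp add: sum_mset_even_partition_seq)
  show "k \<le> num_binary_partitions (int (sum_mset (even_partition_seq k)))"
    using Mj length_even_prefix_step[of M] length_even_prefix_Suc[of M] unfolding sum by linarith
  assume "k \<le> num_binary_partitions (int m)"
  \<comment> \<open>This covers odd \<open>m\<close> as well, since b(2i + 1) = b(2i).\<close>
  also have "\<dots> = length (even_prefix (Suc (m div 2)))"
    by (simp flip: map_drop_ones_binary_partition_list_div add: length_binary_partition_list)
  finally have "length (even_prefix M) < length (even_prefix (Suc (m div 2)))"
    using Mj by linarith
  then have "M < Suc (m div 2)"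
    using length_even_prefix_mono[of "Suc (m div 2)" M] by linarith
  then show "sum_mset (even_partition_seq k) \<le> m" unfolding sum by simp
qed

lemma half_even_partition_seq:
  assumes "k \<ge> 1" and n: "n = sum_mset (even_partition_seq k)"
  shows "\<exists>l\<ge>1. half_partition (even_partition_seq k) = even_partition_seq l \<and>
    (n mod 4 = 0 \<and> int l = int k - int (num_binary_partitions (int n - 2)) \<or>
     n mod 4 = 2 \<and> int l = int (num_binary_partitions (int n)) + 1 - int k)"
proof -
  from assms(1) obtain m j where mj: "j < num_binary_partitions (int m)"
    "k = Suc (length (even_prefix m) + j)" by (rule even_partition_seq_obtain)
  have sum: "n = 2 * m"
    using mj n by (simp add: sum_mset_even_partition_seq)
  show ?thesis
  proof (cases "even m")
    case True
    then have "n mod 4 = 0" using sum by presburger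
    then show ?thesis
      using half_even_partition_seq_even[OF True mj(1)] mj(2) sum length_even_prefix[of m]
      by (intro exI[of _ "Suc j"]) simp
  next
    case False
    then have "n mod 4 = 2" using sum by presburger
    then show ?thesis
      using half_even_partition_seq_odd[OF False mj(1)] mj sum length_even_prefix_Suc[of m]
        length_even_prefix_step[of m]
      \<comment> \<open>With n = 2m and k = b(n - 2) + j + 1, the recurrence b(n) = b(n - 2) + b(m)
        turns b(m) - j into b(n) + 1 - k.\<close>
      by (intro exI[of _ "num_binary_partitions (int m) - j"]) (simp add: of_nat_diff)
  qed
qed

lemma even_partition_determined:
  assumes "even_binary_partition P" "even_binary_partition P'"
    and "half_partition P = half_partition P'" "sum_mset P = sum_mset P'"
  shows "P = P'"
proof -
  obtain Q Q' where "P = double Q" "P' = double Q'"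
    using assms(1,2) by (metis even_partitionE)
  with assms(3,4) show ?thesis using drop_ones_inj[of Q Q'] by simp
qed

text \<open>Needs no new computation: \<open>P\<close> occurs at some \<open>k\<close>, the forward
  direction gives the position of its half, injectivity identifies that with \<open>l\<close>, and
  the equation is solved for \<open>k\<close>.\<close>

lemma even_partition_seq_of_half:
  assumes "even_binary_partition P" "l \<ge> 1" "half_partition P = even_partition_seq l"
    and n: "n = sum_mset P"
  shows "\<exists>k\<ge>1. P = even_partition_seq k \<and>
    (n mod 4 = 0 \<and> int k = int (num_binary_partitions (int n - 2)) + int l \<or>
     n mod 4 = 2 \<and> int k = int (num_binary_partitions (int n)) + 1 - int l)"
proof -
  obtain k where k: "k \<ge> 1" "even_partition_seq k = P"
    using assms(1) by (rule even_partition_seq_surj)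
  obtain l' where l': "l' \<ge> 1" "half_partition P = even_partition_seq l'"
    "n mod 4 = 0 \<and> int l' = int k - int (num_binary_partitions (int n - 2)) \<or>
     n mod 4 = 2 \<and> int l' = int (num_binary_partitions (int n)) + 1 - int k"
    using half_even_partition_seq[of k n] k n by auto
  have "l' = l" using even_partition_seq_inj[of l' l] l' assms by simp
  with k l' show ?thesis by (intro exI[of _ k]) auto
qed

section \<open>Trails and induction along halving\<close>

lemma trail_half: "trail (half_partition P) = (\<lambda>i. trail P (Suc i))"
  by (simp add: trail_def fun_eq_iff funpow_Suc_right del: funpow.simps)

lemma trail_0: "trail P 0 = sum_mset P"
  by (simp add: trail_def)

lemma trail_empty: "trail {#} = (\<lambda>_. 0)"
proof
  fix i
  have "(half_partition ^^ i) {#} = {#}" by (induction i) auto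
  then show "trail {#} i = 0" by (simp add: trail_def)
qed

lemma even_partition_induct [consumes 1, case_names empty half]:
  assumes "even_binary_partition P" "R {#}"
    and "\<And>P. even_binary_partition P \<Longrightarrow> P \<noteq> {#} \<Longrightarrow> R (half_partition P) \<Longrightarrow> R P"
  shows "R P"
  using assms(1)
proof (induction "sum_mset P" arbitrary: P rule: less_induct)
  case less
  then show ?case
    using assms(2) assms(3)[of P] sum_mset_half_less[of P] even_partition_half[of P] by metis
qed

text \<open>The tail of the trail determines the half by induction, the first entry is the sum, and
  these two determine the partition.\<close>

lemma trail_inj: "inj_on trail {P. even_binary_partition P}"
proof -
  have "P = P'" if "even_binary_partition P" "even_binary_partition P'" "trail P = trail P'" for P P'
    using that
  proof (induction P arbitrary: P' rule: even_partition_induct)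
    case empty
    then have "sum_mset P' = 0" by (metis trail_0 trail_empty)
    with empty show ?case
      using binary_partition_sum_0_iff[of P'] by (simp add: even_binary_partition_def)
  next
    case (half P)
    have "half_partition P = half_partition P'"
    proof (rule half.IH)
      show "even_binary_partition (half_partition P')"
        using half.prems(1) by (rule even_partition_half)
      show "trail (half_partition P) = trail (half_partition P')"
        unfolding trail_half half.prems(2) ..
    qed
    moreover have "sum_mset P = sum_mset P'"
      unfolding trail_0[symmetric] half.prems(2) ..
    ultimately show ?case
      using half.hyps(1) half.prems(1) by (metis even_partition_determined)
  qed
  then show ?thesis by (simp add: inj_on_def)
qed

lemma trail_zero_iff:
  assumes "even_binary_partition P"
  shows "trail P = (\<lambda>_. 0) \<longleftrightarrow> P = {#}"
  using inj_onD[OF trail_inj, of P "{#}"] assms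
  by (auto simp: trail_empty even_binary_partition_def)

section \<open>Positions as a function of the trail\<close>

definition partition_position :: "nat multiset \<Rightarrow> nat" where
  "partition_position P = (THE k. k \<ge> 1 \<and> even_partition_seq k = P)"

lemma partition_position_eqI:
  assumes "k \<ge> 1" "even_partition_seq k = P"
  shows "partition_position P = k"
  unfolding partition_position_def using assms by (blast intro: even_partition_seq_inj)

lemma partition_position:
  assumes "even_binary_partition P"
  shows "partition_position P \<ge> 1" "even_partition_seq (partition_position P) = P"
  using even_partition_seq_surj[OF assms] partition_position_eqI by metis+

lemma partition_position_half:
  assumes "even_binary_partition P" and n: "n = sum_mset P"
  shows "n mod 4 = 0 \<and> partition_position P =
      num_binary_partitions (int n - 2) + partition_position (half_partition P) \<or>
    n mod 4 = 2 \<and> int (partition_position P) =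
      int (num_binary_partitions (int n)) + 1 - int (partition_position (half_partition P))"
proof -
  note pos = partition_position[OF even_partition_half[OF assms(1)]]
  obtain k where k: "k \<ge> 1" "P = even_partition_seq k"
    and rec: "n mod 4 = 0 \<and> int k = int (num_binary_partitions (int n - 2))
        + int (partition_position (half_partition P)) \<or>
     n mod 4 = 2 \<and> int k = int (num_binary_partitions (int n)) + 1
        - int (partition_position (half_partition P))"
    using even_partition_seq_of_half[OF assms(1) pos(1) pos(2)[symmetric] n] by (elim exE conjE)
  have "partition_position P = k"
    using k(1) k(2)[symmetric] by (rule partition_position_eqI)
  with rec show ?thesis by linarith
qed

lemma partition_position_empty: "partition_position {#} = 1"
  by (rule partition_position_eqI) (simp_all add: even_partition_seq_1[simplified])

lemma trail_position_recurrence_exists: "\<exists>pos. trail_position_recurrence pos"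
proof -
  \<comment> \<open>Injectivity of \<open>trail\<close> lets the position be read as a function of
    the trail; values at other sequences are arbitrary.\<close>
  define pos where
    "pos \<tau> = partition_position (the_inv_into {P. even_binary_partition P} trail \<tau>)" for \<tau>
  have pos: "pos (trail P) = partition_position P" if "even_binary_partition P" for P
    using that by (simp add: pos_def the_inv_into_f_f[OF trail_inj])
  have "pos (\<lambda>_. 0) = num_binary_partitions 0"
    using pos[of "{#}"]
    by (simp add: trail_empty partition_position_empty num_binary_partitions_0
        even_binary_partition_def)
  moreover have "(trail P 0 mod 4 = 0 \<longrightarrow> pos (trail P) =
        num_binary_partitions (int (trail P 0) - 2) + pos (\<lambda>i. trail P (Suc i))) \<and>
      (trail P 0 mod 4 = 2 \<longrightarrow> int (pos (trail P)) =
        int (num_binary_partitions (int (trail P 0))) + 1 - int (pos (\<lambda>i. trail P (Suc i))))"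
    if "even_binary_partition P" for P
    using partition_position_half[OF that trail_0]
    unfolding pos[OF that] pos[OF even_partition_half[OF that], unfolded trail_half] by linarith
  ultimately have "trail_position_recurrence pos"
    unfolding trail_position_recurrence_def by simp
  then show ?thesis by blast
qed

text \<open>Induction along halving. At \<open>{#}\<close> the recurrence only says pos = b(-2) +
  pos with b(-2) = 0, so the base case must supply the value there.\<close>

lemma trail_position_recurrence_unique:
  assumes "trail_position_recurrence pos" "even_binary_partition P"
  shows "pos (trail P) = partition_position P"
  using assms(2)
proof (induction P rule: even_partition_induct)
  case empty
  then show ?case using assms(1)
    by (simp add: trail_position_recurrence_def trail_empty partition_position_empty
        num_binary_partitions_0)
next
  case (half P)
  from assms(1) half(1) have
    "trail P 0 mod 4 = 0 \<longrightarrow> pos (trail P) =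
        num_binary_partitions (int (trail P 0) - 2) + pos (trail (half_partition P))"
    "trail P 0 mod 4 = 2 \<longrightarrow> int (pos (trail P)) =
        int (num_binary_partitions (int (trail P 0))) + 1 - int (pos (trail (half_partition P)))"
    unfolding trail_position_recurrence_def trail_half by simp_all
  then show ?case
    using partition_position_half[OF half(1) trail_0] unfolding half.IH by linarith
qed

text \<open>The existence of a solution \<open>pos\<close> keeps the final clause from being
  vacuous.\<close>

theorem theorem3:
  shows
    "(\<forall>k\<ge>1. \<forall>n. n = sum_mset (even_partition_seq k) \<longrightarrow>
        (k \<le> num_binary_partitions (int n) \<and>
         (\<forall>m::nat. k \<le> num_binary_partitions (int m) \<longrightarrow> n \<le> m)) \<and>
        (\<exists>l\<ge>1. half_partition (even_partition_seq k) = even_partition_seq l \<and>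
           (n mod 4 = 0 \<and> int l = int k - int (num_binary_partitions (int n - 2)) \<or>
            n mod 4 = 2 \<and> int l = int (num_binary_partitions (int n)) + 1 - int k)))
     \<and>
     (\<forall>P \<tau>. even_binary_partition P \<and> \<tau> = trail P \<longrightarrow>
        trail (half_partition P) = (\<lambda>i. \<tau> (Suc i)) \<and>
        (\<forall>l\<ge>1. half_partition P = even_partition_seq l \<longrightarrow>
           (\<exists>k\<ge>1. P = even_partition_seq k \<and>
              (\<tau> 0 mod 4 = 0 \<and> int k = int (num_binary_partitions (int (\<tau> 0) - 2)) + int l \<or>
               \<tau> 0 mod 4 = 2 \<and> int k = int (num_binary_partitions (int (\<tau> 0))) + 1 - int l))))
     \<and>
     (\<forall>P. even_binary_partition P \<longrightarrow> (trail P = (\<lambda>_. 0) \<longleftrightarrow> P = {#})) \<and>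
     num_binary_partitions 0 = 1 \<and> even_partition_seq 1 = {#}
     \<and>
     inj_on trail {P. even_binary_partition P} \<and>
     (\<exists>pos. trail_position_recurrence pos) \<and>
     (\<forall>pos. trail_position_recurrence pos \<longrightarrow>
        (\<forall>P. even_binary_partition P \<longrightarrow>
           pos (trail P) \<ge> 1 \<and>
           (\<forall>k\<ge>1. even_partition_seq k = P \<longleftrightarrow> k = pos (trail P))))"
proof (intro conjI)
  show "\<forall>k\<ge>1. \<forall>n. n = sum_mset (even_partition_seq k) \<longrightarrow>
        (k \<le> num_binary_partitions (int n) \<and>
         (\<forall>m::nat. k \<le> num_binary_partitions (int m) \<longrightarrow> n \<le> m)) \<and>
        (\<exists>l\<ge>1. half_partition (even_partition_seq k) = even_partition_seq l \<and>
           (n mod 4 = 0 \<and> int l = int k - int (num_binary_partitions (int n - 2)) \<or>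
            n mod 4 = 2 \<and> int l = int (num_binary_partitions (int n)) + 1 - int k))"
    by (intro allI impI conjI)
      (simp_all only: even_partition_seq_sum_least half_even_partition_seq)
  show "\<forall>P \<tau>. even_binary_partition P \<and> \<tau> = trail P \<longrightarrow>
        trail (half_partition P) = (\<lambda>i. \<tau> (Suc i)) \<and>
        (\<forall>l\<ge>1. half_partition P = even_partition_seq l \<longrightarrow>
           (\<exists>k\<ge>1. P = even_partition_seq k \<and>
              (\<tau> 0 mod 4 = 0 \<and> int k = int (num_binary_partitions (int (\<tau> 0) - 2)) + int l \<or>
               \<tau> 0 mod 4 = 2 \<and> int k = int (num_binary_partitions (int (\<tau> 0))) + 1 - int l)))"
    by (intro allI impI conjI)
      (simp_all only: trail_half, simp only: even_partition_seq_of_half trail_0)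
  show "\<forall>pos. trail_position_recurrence pos \<longrightarrow>
        (\<forall>P. even_binary_partition P \<longrightarrow>
           pos (trail P) \<ge> 1 \<and>
           (\<forall>k\<ge>1. even_partition_seq k = P \<longleftrightarrow> k = pos (trail P)))"
  proof (intro allI impI conjI)
    fix pos P and k :: nat
    assume "trail_position_recurrence pos" and P: "even_binary_partition P"
    \<comment> \<open>Every solution agrees with the true position, so the claim reduces to
      \<open>partition_position\<close> being inverse to the sequence.\<close>
    then have pos: "pos (trail P) = partition_position P"
      by (rule trail_position_recurrence_unique)
    show "pos (trail P) \<ge> 1"
      unfolding pos using P by (rule partition_position)
    assume "k \<ge> 1"
    then show "even_partition_seq k = P \<longleftrightarrow> k = pos (trail P)"
      unfolding pos using partition_position(2)[OF P] partition_position_eqI[of k P] by auto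
  qed
qed (use trail_zero_iff num_binary_partitions_0 even_partition_seq_1 trail_inj
    trail_position_recurrence_exists in auto)

end
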